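(* Suppose $\{h_n\}_{n\ge0}$ is a non-negative sequence, $0<q<1$ is fixed, and $h(a;x)$ is the (formal) power series in $x$ $$h(a;x)=\sum_{n=0}^{\infty}\frac{h_nx^n}{(a;q)_n} .$$ Then the generalized Turánian $$\Delta_h(\alpha,\beta;x)=h(q^{\mu+\alpha};x)h(q^{\mu+\beta};x)-h(q^{\mu};x)h(q^{\mu+\alpha+\beta};x)$$ has negative coefficients at all positive powers of $x$ for all $\mu,\alpha,\beta>0$. In particular, the function $\mu\mapsto h(q^{\mu};x)$ is log-convex on $(0,\infty)$ for each fixed $x>0$ in the domain of convergence.
   Context: For $0<q<1$ and complex $a$: $(a;q)_0=1$, $(a;q)_n=\prod_{k=0}^{n-1}(1-aq^k)$ for $n\ge1$. A positive function is log-convex if its logarithm is convex.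
   Formalization: Coefficients at positive powers x^n are proved non-positive, and strictly negative when some product h_k h_{n-k} (k ≤ n) is nonzero, since otherwise they vanish (e.g. h_n=0 for all n≥1); log-convexity is stated for sequences not identically zero. *)

theory Defs
  imports "HOL-Analysis.Analysis"
begin

definition qpoch :: "'a::real_normed_field \<Rightarrow> real \<Rightarrow> nat \<Rightarrow> 'a" where
  "qpoch a q n = (\<Prod>k<n. 1 - a * of_real q ^ k)"

text \<open>The base and the coefficient sequence are real; the parameter \<open>a\<close> may be real or complex.\<close>

definition hseries :: "(nat \<Rightarrow> real) \<Rightarrow> real \<Rightarrow> 'a::real_normed_field \<Rightarrow> 'a fps" where
  "hseries h q a = Abs_fps (\<lambda>n. of_real (h n) / qpoch a q n)"

definition turanian :: "(nat \<Rightarrow> real) \<Rightarrow> real \<Rightarrow> real \<Rightarrow> real \<Rightarrow> real \<Rightarrow> real fps" where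
  "turanian h q \<mu> \<alpha> \<beta> =
     hseries h q (q powr (\<mu> + \<alpha>)) * hseries h q (q powr (\<mu> + \<beta>))
     - hseries h q (q powr \<mu>) * hseries h q (q powr (\<mu> + \<alpha> + \<beta>))"

definition log_convex_on :: "real set \<Rightarrow> (real \<Rightarrow> real) \<Rightarrow> bool" where
  "log_convex_on S f \<longleftrightarrow> (\<forall>t\<in>S. f t > 0) \<and> convex_on S (\<lambda>t. ln (f t))"

text \<open>The points at which the series converges for every parameter \<open>q powr \<mu>\<close> with \<open>\<mu> > 0\<close>,
  including boundary points of the disc of convergence.\<close>

definition hdomain :: "(nat \<Rightarrow> real) \<Rightarrow> real \<Rightarrow> real set" where
  "hdomain h q = {x. \<forall>\<mu>>0. summable (\<lambda>n. fps_nth (hseries h q (q powr \<mu>)) n * x ^ n)}"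

end

theory Submission
  imports Defs
begin

text \<open>
  Collecting the terms with indices \<open>k\<close> and \<open>m = n - k\<close>, the coefficient of \<open>x ^ n\<close> in the Turanian is
  half the sum of \<open>h k * h m\<close> times
  \<open>u(aA,k) u(aB,m) + u(aA,m) u(aB,k) - u(a,k) u(aAB,m) - u(a,m) u(aAB,k)\<close>, where
  \<open>u(t,k) = 1 / (t;q)_k\<close>, \<open>a = q powr \<mu>\<close>, \<open>A = q powr \<alpha>\<close>, \<open>B = q powr \<beta>\<close>.
  For \<open>k \<le> m\<close> one factors \<open>u(t,m) = u(t,k) u(tq^k,m-k)\<close>; both factors are increasing in \<open>t\<close> and
  multiplicatively convex, because \<open>(1 - a)(1 - aAB) \<le> (1 - aA)(1 - aB)\<close>, and this makes the bracket negative.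
  Log-convexity passes from the terms of the series to the sum by Hoelder's inequality, which reduces
  to the weighted arithmetic-geometric mean inequality.
\<close>

section \<open>The q-shifted factorial\<close>

lemma qpoch_add: "qpoch a q (k + m) = qpoch a q k * qpoch (a * of_real q ^ k) q m"
  by (induction m) (simp_all add: qpoch_def power_add mult_ac)

lemma mult_power_less_one:
  fixes a q :: real
  assumes "0 \<le> a" "a < 1" "0 < q" "q < 1"
  shows "a * q ^ n < 1"
proof -
  have "a * q ^ n \<le> a * 1"
    using assms by (intro mult_left_mono power_le_one) auto
  then show ?thesis using assms by simp
qed

lemma qpoch_pos:
  fixes a q :: real
  assumes "0 \<le> a" "a < 1" "0 < q" "q < 1"
  shows "0 < qpoch a q n"
  unfolding qpoch_def using mult_power_less_one[OF assms] by (intro prod_pos) simp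

lemma qpoch_antimono:
  fixes a b q :: real
  assumes "0 \<le> a" "a \<le> b" "b < 1" "0 < q" "q < 1"
  shows "qpoch b q n \<le> qpoch a q n"
  unfolding qpoch_def
proof (intro prod_mono conjI)
  fix k
  show "0 \<le> 1 - b * of_real q ^ k"
    using mult_power_less_one[of b q k] assms by simp
  show "1 - b * of_real q ^ k \<le> 1 - a * of_real q ^ k"
    using assms by (simp add: mult_right_mono)
qed

text \<open>The inequality holds factor by factor: with \<open>x = a * q ^ k\<close>, the right-hand
  factor exceeds the left-hand one by exactly \<open>x * (1 - A) * (1 - B)\<close>. Since the
  factors are positive, it survives taking products, strictly as soon as there is a factor.\<close>

lemma qpoch_turan_le:
  fixes a A B q :: real
  assumes "0 < a" "a < 1" "0 < A" "A < 1" "0 < B" "B < 1" "0 < q" "q < 1"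
  shows "qpoch a q n * qpoch (a * A * B) q n \<le> qpoch (a * A) q n * qpoch (a * B) q n"
    and "0 < n \<Longrightarrow>
      qpoch a q n * qpoch (a * A * B) q n < qpoch (a * A) q n * qpoch (a * B) q n"
proof -
  have lt1: "a * A < 1" "a * B < 1" "a * A * B < 1"
    using assms by (smt (verit) mult_less_cancel_left1 mult_pos_pos)+
  have fpos: "0 < 1 - t * q ^ k" if "0 \<le> t" "t < 1" for t k
    using mult_power_less_one[OF that] assms by simp
  have factor: "(1 - a * q ^ k) * (1 - a * A * B * q ^ k) < (1 - a * A * q ^ k) * (1 - a * B * q ^ k)" for k
  proof -
    have "0 < a * q ^ k * (1 - A) * (1 - B)" using assms by simp
    then show ?thesis by (simp add: algebra_simps)
  qed
  have facpos: "0 < (1 - a * q ^ k) * (1 - a * A * B * q ^ k)" for k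
    using fpos assms lt1 by simp
  have rw: "qpoch s q n * qpoch t q n = (\<Prod>k<n. (1 - s * q ^ k) * (1 - t * q ^ k))" for s t :: real
    by (simp add: qpoch_def prod.distrib)
  show "qpoch a q n * qpoch (a * A * B) q n \<le> qpoch (a * A) q n * qpoch (a * B) q n"
    unfolding rw using factor facpos by (intro prod_mono) (auto intro: less_imp_le)
  show "qpoch a q n * qpoch (a * A * B) q n < qpoch (a * A) q n * qpoch (a * B) q n" if "0 < n"
    unfolding rw using factor facpos that
    by (intro prod_mono_strict) (auto intro: less_imp_le less_trans)
qed

section \<open>Coefficients of the Turanian\<close>

text \<open>Turns a product comparison into a sum comparison when \<open>r0\<close> is the largest
  of \<open>r0\<close>, \<open>r1\<close>, \<open>r2\<close>: expand
  \<open>(r0 - r1) * (r0 - r2) \<ge> 0\<close>, insert the product bound and cancel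
  \<open>r0\<close>.\<close>

lemma add_le_add_of_mult_le:
  fixes r0 :: real
  assumes "0 < r0" "r1 \<le> r0" "r2 \<le> r0" "r1 * r2 \<le> r0 * r3"
  shows "r1 + r2 \<le> r0 + r3" and "r1 * r2 < r0 * r3 \<Longrightarrow> r1 + r2 < r0 + r3"
proof -
  have "0 \<le> (r0 - r1) * (r0 - r2)" using assms by simp
  then have *: "r0 * (r1 + r2) + (r0 * r3 - r1 * r2) \<le> r0 * (r0 + r3)"
    by (simp add: algebra_simps)
  have "r0 * (r1 + r2) \<le> r0 * (r0 + r3)" using * assms(4) by linarith
  then show "r1 + r2 \<le> r0 + r3" using assms(1) by (simp only: mult_le_cancel_left_pos)
  assume "r1 * r2 < r0 * r3"
  with * have "r0 * (r1 + r2) < r0 * (r0 + r3)" by linarith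
  then show "r1 + r2 < r0 + r3" using assms(1) by (simp only: mult_less_cancel_left_pos)
qed

text \<open>With \<open>P\<close> for the first \<open>k\<close> factors and \<open>R\<close> for
  the remaining \<open>d\<close>, each side takes the shape \<open>P s * P t * (R s + R t)\<close>.
  The products of \<open>P\<close> and the sums of \<open>R\<close> can then be compared
  separately.\<close>

lemma qpoch_cross_terms_less:
  fixes a A B q :: real
  assumes "0 < a" "a < 1" "0 < A" "A < 1" "0 < B" "B < 1" "0 < q" "q < 1"
    and "k \<le> m" "0 < m"
  shows "1 / (qpoch (a * A) q k * qpoch (a * B) q m) + 1 / (qpoch (a * A) q m * qpoch (a * B) q k)
       < 1 / (qpoch a q k * qpoch (a * A * B) q m) + 1 / (qpoch a q m * qpoch (a * A * B) q k)"
proof -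
  obtain d where m: "m = k + d" using \<open>k \<le> m\<close> le_Suc_ex by blast
  define P where "P t = 1 / qpoch t q k" for t :: real
  define R where "R t = 1 / qpoch (t * q ^ k) q d" for t :: real
  have u: "1 / qpoch t q m = P t * R t" for t
    by (simp add: P_def R_def m qpoch_add)
  have dom: "0 < a * A" "a * A \<le> a" "0 < a * B" "a * B \<le> a" "0 < a * A * B" "a * A * B \<le> a * B"
    using assms by (simp_all add: mult_le_cancel_left1 mult_le_cancel_right1)
  have Ppos: "0 < P t" if "0 < t" "t \<le> a" for t
    unfolding P_def using that assms by (simp add: qpoch_pos)
  have Rpos: "0 < R t" if "0 < t" "t \<le> a" for t
    unfolding R_def using that assms by (simp add: qpoch_pos mult_power_less_one)
  have Rmono: "R t \<le> R a" if "0 < t" "t \<le> a" for t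
    unfolding R_def using that assms
    by (intro divide_left_mono qpoch_antimono mult_pos_pos qpoch_pos)
       (auto simp: mult_power_less_one mult_right_mono)
  have shift: "0 < a * q ^ k" "a * q ^ k < 1"
    using assms by (simp_all add: mult_power_less_one)
  have inv: "1 / y * (1 / z) \<le> 1 / w * (1 / x)" "w * x < y * z \<Longrightarrow> 1 / y * (1 / z) < 1 / w * (1 / x)"
    if "w * x \<le> y * z" "0 < w" "0 < x" for w x y z :: real
  proof -
    have "0 < w * x" using that by simp
    then show "1 / y * (1 / z) \<le> 1 / w * (1 / x)" "w * x < y * z \<Longrightarrow> 1 / y * (1 / z) < 1 / w * (1 / x)"
      using that frac_le[of 1 1 "w * x" "y * z"] frac_less2[of 1 1 "w * x" "y * z"] by simp_all
  qed
  note Pt = qpoch_turan_le[OF assms(1-8), of k]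
  \<comment> \<open>The tail \<open>R\<close> starts at the \<open>k\<close>-th factor, so the
    product inequality is used with \<open>a * q ^ k\<close> in place of \<open>a\<close>.\<close>
  note Rt = qpoch_turan_le[OF shift assms(3-8), of d]
  have q1: "0 < qpoch a q k" "0 < qpoch (a * A * B) q k"
    using assms dom by (auto intro!: qpoch_pos)
  have "a * A * B < 1" using dom \<open>a < 1\<close> by linarith
  then have q2: "0 < qpoch (a * q ^ k) q d" "0 < qpoch (a * q ^ k * A * B) q d"
    using assms dom shift mult_power_less_one[of "a * A * B" q k]
    by (auto intro!: qpoch_pos simp: mult.commute mult.left_commute)
  have Pprod: "P (a * A) * P (a * B) \<le> P a * P (a * A * B)"
    and Pprod': "0 < k \<Longrightarrow> P (a * A) * P (a * B) < P a * P (a * A * B)"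
    unfolding P_def using inv[OF Pt(1) q1] Pt(2) by blast+
  have Rprod: "R (a * A) * R (a * B) \<le> R a * R (a * A * B)"
    and Rprod': "0 < d \<Longrightarrow> R (a * A) * R (a * B) < R a * R (a * A * B)"
    unfolding R_def using inv[OF Rt(1) q2] Rt(2) by (simp_all add: mult_ac)
  \<comment> \<open>Here \<open>R a\<close> plays the dominating \<open>r0\<close>, because
    \<open>R\<close> increases with its argument and \<open>a * A\<close>, \<open>a * B\<close> lie
    below \<open>a\<close>.\<close>
  note Rs = add_le_add_of_mult_le[OF Rpos Rmono Rmono Rprod]
  have Rsum: "R (a * A) + R (a * B) \<le> R a + R (a * A * B)"
    and Rsum': "0 < d \<Longrightarrow> R (a * A) + R (a * B) < R a + R (a * A * B)"
    using Rs Rprod' dom \<open>0 < a\<close> by simp_all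
  have pos: "0 < P (a * A) * P (a * B)" "0 < P a * P (a * A * B)" "0 < R (a * A) + R (a * B)"
    using dom \<open>0 < a\<close> by (simp_all only: mult_pos_pos Ppos add_pos_pos Rpos order_refl)
  \<comment> \<open>Strictness comes from the \<open>P\<close> products when \<open>k > 0\<close>.
    For \<open>k = 0\<close> these are empty, but then \<open>d = m > 0\<close> and the
    \<open>R\<close> sums are strict.\<close>
  have "(P (a * A) * P (a * B)) * (R (a * A) + R (a * B)) < (P a * P (a * A * B)) * (R a + R (a * A * B))"
  proof (cases "0 < k")
    case True
    from mult_strict_right_mono[OF Pprod'[OF True] pos(3)] mult_left_mono[OF Rsum less_imp_le[OF pos(2)]]
    show ?thesis by linarith
  next
    case False
    then have "0 < d" using \<open>0 < m\<close> m by simp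
    from mult_right_mono[OF Pprod less_imp_le[OF pos(3)]] mult_strict_left_mono[OF Rsum'[OF this] pos(2)]
    show ?thesis by linarith
  qed
  moreover have "1 / (qpoch s q k * qpoch t q m) = P s * (P t * R t)"
    "1 / (qpoch s q m * qpoch t q k) = (P s * R s) * P t"
    for s t unfolding u[symmetric] by (simp_all add: P_def)
  ultimately show ?thesis by (simp add: algebra_simps)
qed

text \<open>Averaging the Cauchy product with its reversal \<open>k \<mapsto> n - k\<close> is what
  gives every summand a sign; the doubling avoids a factor one half.\<close>

lemma two_turanian_nth:
  fixes h :: "nat \<Rightarrow> real" and q \<mu> \<alpha> \<beta> :: real
  defines "a \<equiv> q powr \<mu>" and "A \<equiv> q powr \<alpha>" and "B \<equiv> q powr \<beta>"
  shows "2 * fps_nth (turanian h q \<mu> \<alpha> \<beta>) n =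
    (\<Sum>k=0..n. h k * h (n - k) *
      ((1 / (qpoch (a * A) q k * qpoch (a * B) q (n - k)) + 1 / (qpoch (a * A) q (n - k) * qpoch (a * B) q k))
     - (1 / (qpoch a q k * qpoch (a * A * B) q (n - k)) + 1 / (qpoch a q (n - k) * qpoch (a * A * B) q k))))"
proof -
  have sym: "2 * fps_nth (hseries h q s * hseries h q t) n =
    (\<Sum>k=0..n. h k * h (n - k) * (1 / (qpoch s q k * qpoch t q (n - k)) + 1 / (qpoch s q (n - k) * qpoch t q k)))"
    for s t :: real
  proof -
    define g where "g k = h k * h (n - k) * (1 / (qpoch s q k * qpoch t q (n - k)))" for k
    have "fps_nth (hseries h q s * hseries h q t) n = (\<Sum>k=0..n. g k)"
      by (simp add: fps_mult_nth hseries_def g_def)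
    moreover have "(\<Sum>k=0..n. g k) = (\<Sum>k=0..n. g (n - k))"
      using sum.atLeastAtMost_rev[of g 0 n] by simp
    ultimately have "2 * fps_nth (hseries h q s * hseries h q t) n = (\<Sum>k=0..n. g k + g (n - k))"
      by (simp add: sum.distrib)
    also have "\<dots> = (\<Sum>k=0..n. h k * h (n - k) *
        (1 / (qpoch s q k * qpoch t q (n - k)) + 1 / (qpoch s q (n - k) * qpoch t q k)))"
      by (intro sum.cong) (auto simp: g_def algebra_simps)
    finally show ?thesis .
  qed
  have ab: "q powr (\<mu> + \<alpha>) = a * A" "q powr (\<mu> + \<beta>) = a * B" "q powr (\<mu> + \<alpha> + \<beta>) = a * A * B"
    by (simp_all add: a_def A_def B_def powr_add)
  have "2 * fps_nth (turanian h q \<mu> \<alpha> \<beta>) n =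
      2 * fps_nth (hseries h q (a * A) * hseries h q (a * B)) n
    - 2 * fps_nth (hseries h q a * hseries h q (a * A * B)) n"
    unfolding turanian_def ab by (simp add: a_def)
  then show ?thesis
    unfolding sym by (simp only: sum_subtractf right_diff_distrib)
qed

lemma turanian_nth_neg:
  fixes h :: "nat \<Rightarrow> real" and q :: real
  assumes h: "\<And>n. 0 \<le> h n" and q: "0 < q" "q < 1"
    and "0 < \<mu>" "0 < \<alpha>" "0 < \<beta>" and n: "0 < n"
  shows "fps_nth (turanian h q \<mu> \<alpha> \<beta>) n \<le> 0"
    and "\<exists>k\<le>n. h k \<noteq> 0 \<and> h (n - k) \<noteq> 0 \<Longrightarrow> fps_nth (turanian h q \<mu> \<alpha> \<beta>) n < 0"
proof -
  define a A B where "a = q powr \<mu>" and "A = q powr \<alpha>" and "B = q powr \<beta>"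
  have r: "0 < q powr t \<and> q powr t < 1" if "0 < t" for t
    using q that by (simp add: powr01_less_one)
  have dom: "0 < a" "a < 1" "0 < A" "A < 1" "0 < B" "B < 1"
    using r assms by (auto simp: a_def A_def B_def)
  define T where "T k =
    (1 / (qpoch (a * A) q k * qpoch (a * B) q (n - k)) + 1 / (qpoch (a * A) q (n - k) * qpoch (a * B) q k))
    - (1 / (qpoch a q k * qpoch (a * A * B) q (n - k)) + 1 / (qpoch a q (n - k) * qpoch (a * A * B) q k))" for k
  \<comment> \<open>\<open>T\<close> is invariant under exchanging \<open>k\<close> and
    \<open>n - k\<close>, so the smaller index may take the first place; the larger one is positive
    as \<open>n > 0\<close>.\<close>
  have T: "T k < 0" if "k \<le> n" for k
  proof (cases "k \<le> n - k")
    case True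
    then show ?thesis
      using qpoch_cross_terms_less[OF dom q True] n that by (simp add: T_def)
  next
    case False
    then show ?thesis
      using qpoch_cross_terms_less[OF dom q, of "n - k" k] n that by (simp add: T_def)
  qed
  have two: "2 * fps_nth (turanian h q \<mu> \<alpha> \<beta>) n = (\<Sum>k=0..n. h k * h (n - k) * T k)"
    unfolding T_def a_def A_def B_def by (rule two_turanian_nth)
  have le: "h k * h (n - k) * T k \<le> 0" if "k \<le> n" for k
    using T[OF that] h by (simp add: mult_nonneg_nonpos)
  show "fps_nth (turanian h q \<mu> \<alpha> \<beta>) n \<le> 0"
    using two le sum_nonpos[of "{0..n}" "\<lambda>k. h k * h (n - k) * T k"] by simp
  assume "\<exists>k\<le>n. h k \<noteq> 0 \<and> h (n - k) \<noteq> 0"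
  then obtain k where k: "k \<le> n" "h k \<noteq> 0" "h (n - k) \<noteq> 0" by blast
  then have "0 < h k" "0 < h (n - k)" using h[of k] h[of "n - k"] by simp_all
  then have "h k * h (n - k) * T k < 0" using T[OF k(1)] by (simp add: mult_pos_neg)
  then have "(\<Sum>k=0..n. h k * h (n - k) * T k) < (\<Sum>k=0..n. 0)"
    using le k by (intro sum_strict_mono_ex1) auto
  then show "fps_nth (turanian h q \<mu> \<alpha> \<beta>) n < 0" using two by simp
qed

section \<open>Log-convexity\<close>

text \<open>Two-term Hoelder for the pairs \<open>(1 - x, x)\<close> and \<open>(1 - y, y)\<close>,
  each of total 1: add the two weighted mean inequalities.\<close>

lemma Hoelder_one_minus:
  fixes x y u v :: real
  assumes "0 < x" "x < 1" "0 < y" "y < 1" "0 \<le> u" "0 \<le> v" "u + v = 1"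
  shows "(1 - x) powr u * (1 - y) powr v \<le> 1 - x powr u * y powr v"
proof -
  have "(1 - x) powr u * (1 - y) powr v \<le> u * (1 - x) + v * (1 - y)"
    and "x powr u * y powr v \<le> u * x + v * y"
    using assms by (auto intro: Youngs_inequality_0)
  moreover have "u * (1 - x) + v * (1 - y) + (u * x + v * y) = 1"
    using assms(7) by (simp add: algebra_simps)
  ultimately show ?thesis by linarith
qed

text \<open>Log-concavity in the exponent, inherited from each factor
  \<open>1 - q powr (s + k)\<close>. Taking reciprocals makes every term of the series
  log-convex.\<close>

lemma qpoch_powr_Hoelder:
  fixes q s t u v :: real
  assumes "0 < q" "q < 1" "0 < s" "0 < t" "0 \<le> u" "0 \<le> v" "u + v = 1"
  shows "qpoch (q powr s) q n powr u * qpoch (q powr t) q n powr v \<le> qpoch (q powr (u * s + v * t)) q n"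
proof -
  have f: "0 < q powr r * q ^ k \<and> q powr r * q ^ k < 1" if "0 < r" for r k
    using assms that by (simp add: mult_power_less_one powr01_less_one)
  have "qpoch (q powr s) q n powr u * qpoch (q powr t) q n powr v =
      (\<Prod>k<n. (1 - q powr s * q ^ k) powr u * (1 - q powr t * q ^ k) powr v)"
    using f assms by (simp add: qpoch_def prod_powr_distrib less_imp_le prod.distrib)
  also have "\<dots> \<le> (\<Prod>k<n. 1 - q powr (u * s + v * t) * q ^ k)"
  proof (intro prod_mono conjI)
    fix k
    have "(q powr s * q ^ k) powr u * (q powr t * q ^ k) powr v
        = q powr (u * (s + real k) + v * (t + real k))"
      using assms by (simp add: powr_powr mult.commute flip: powr_realpow powr_add)
    \<comment> \<open>Because \<open>u + v = 1\<close>, the shift by \<open>k\<close> passes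
      unchanged through the convex combination.\<close>
    also have "u * (s + real k) + v * (t + real k) = (u * s + v * t) + (u + v) * real k"
      by (simp add: algebra_simps)
    also have "q powr \<dots> = q powr (u * s + v * t) * q ^ k"
      using assms by (simp add: powr_add powr_realpow)
    finally show "(1 - q powr s * q ^ k) powr u * (1 - q powr t * q ^ k) powr v
        \<le> 1 - q powr (u * s + v * t) * q ^ k"
      using Hoelder_one_minus[of "q powr s * q ^ k" "q powr t * q ^ k" u v] f assms by simp
  qed simp
  finally show ?thesis by (simp add: qpoch_def)
qed

text \<open>Normalise \<open>f\<close> and \<open>g\<close> to total 1; the weighted mean inequality
  bounds each term, and the bounds sum to \<open>u + v = 1\<close> times the prefactor.\<close>

lemma suminf_Hoelder:
  fixes f g c :: "nat \<Rightarrow> real"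
  assumes f: "summable f" "\<And>n. 0 \<le> f n" and g: "summable g" "\<And>n. 0 \<le> g n"
    and "summable c" and c: "\<And>n. c n \<le> f n powr u * g n powr v"
    and uv: "0 < u" "0 < v" "u + v = 1"
    and pos: "0 < suminf f" "0 < suminf g"
  shows "suminf c \<le> suminf f powr u * suminf g powr v"
proof -
  define F G where "F = suminf f" and "G = suminf g"
  have FG: "0 < F" "0 < G" using pos by (simp_all add: F_def G_def)
  have bound: "c n \<le> F powr u * G powr v * (u * (f n / F) + v * (g n / G))" for n
  proof (cases "f n = 0 \<or> g n = 0")
    case True
    \<comment> \<open>A zero base gives \<open>0 powr u = 0\<close>, so vanishing terms are settled
      before the mean inequality is applied to positive arguments.\<close>
    then have "c n \<le> 0" using c[of n] uv by auto
    also have "0 \<le> F powr u * G powr v * (u * (f n / F) + v * (g n / G))"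
      using FG f g uv by simp
    finally show ?thesis .
  next
    case False
    then have fg: "0 < f n" "0 < g n" using f(2)[of n] g(2)[of n] by simp_all
    have "c n \<le> f n powr u * g n powr v" by (rule c)
    also have "\<dots> = F powr u * G powr v * ((f n / F) powr u * (g n / G) powr v)"
      using fg FG by (simp add: powr_divide)
    also have "\<dots> \<le> F powr u * G powr v * (u * (f n / F) + v * (g n / G))"
      using fg FG uv by (intro mult_left_mono Youngs_inequality_0) auto
    finally show ?thesis .
  qed
  have "(\<lambda>n. u * (f n / F) + v * (g n / G)) sums (u * (F / F) + v * (G / G))"
    unfolding F_def G_def by (intro sums_add sums_mult sums_divide summable_sums f g)
  then have "(\<lambda>n. F powr u * G powr v * (u * (f n / F) + v * (g n / G))) sums (F powr u * G powr v * 1)"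
    using FG uv by (intro sums_mult) simp
  then show ?thesis
    using sums_le[OF bound summable_sums[OF \<open>summable c\<close>]] by (simp add: F_def G_def)
qed

lemma log_convex_on_hseries:
  fixes h :: "nat \<Rightarrow> real" and q x :: real
  assumes h: "\<And>n. 0 \<le> h n" "\<exists>n. h n \<noteq> 0" and q: "0 < q" "q < 1"
    and x: "0 < x" "x \<in> hdomain h q"
  shows "log_convex_on {0<..} (\<lambda>\<mu>. eval_fps (hseries h q (q powr \<mu>)) x)"
proof -
  define c where "c \<mu> n = h n * x ^ n / qpoch (q powr \<mu>) q n" for \<mu> n
  define F where "F \<mu> = (\<Sum>n. c \<mu> n)" for \<mu>
  have F: "eval_fps (hseries h q (q powr \<mu>)) x = F \<mu>" for \<mu>
    by (simp add: eval_fps_def hseries_def F_def c_def)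
  have sm: "summable (c \<mu>)" if "0 < \<mu>" for \<mu>
    using x(2) that by (simp add: hdomain_def hseries_def c_def[abs_def])
  have Q: "0 < qpoch (q powr \<mu>) q n" if "0 < \<mu>" for \<mu> n
    using q that by (intro qpoch_pos) (auto simp: powr01_less_one)
  have nonneg: "0 \<le> c \<mu> n" if "0 < \<mu>" for \<mu> n
    using h(1) x(1) Q[OF that, of n] by (simp add: c_def)
  have Fpos: "0 < F \<mu>" if "0 < \<mu>" for \<mu>
  proof -
    \<comment> \<open>One positive term makes the sum positive, so its logarithm is
      meaningful.\<close>
    from h obtain n where "0 < h n" by (metis less_eq_real_def)
    then have "0 < c \<mu> n" using x(1) Q[OF that] by (simp add: c_def)
    then show ?thesis
      unfolding F_def by (rule suminf_pos2[OF sm[OF that] nonneg[OF that]])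
  qed
  have "ln (F ((1 - t) *\<^sub>R \<mu> + t *\<^sub>R \<nu>)) \<le> (1 - t) * ln (F \<mu>) + t * ln (F \<nu>)"
    if t: "0 < t" "t < 1" and \<mu>\<nu>: "\<mu> \<in> {0<..}" "\<nu> \<in> {0<..}" for t \<mu> \<nu>
  proof -
    define u where "u = 1 - t"
    define w where "w = u * \<mu> + t * \<nu>"
    have ut: "0 < u" "u + t = 1" and p: "0 < \<mu>" "0 < \<nu>" using t \<mu>\<nu> by (simp_all add: u_def)
    have w: "0 < w" using p ut t by (simp add: w_def add_pos_pos)
    have term_le: "c w n \<le> c \<mu> n powr u * c \<nu> n powr t" for n
    proof -
      define b where "b = h n * x ^ n"
      define K where "K = qpoch (q powr \<mu>) q n powr u * qpoch (q powr \<nu>) q n powr t"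
      have b: "0 \<le> b" using h x by (simp add: b_def)
      have K: "0 < K" using Q[OF p(1), of n] Q[OF p(2), of n] by (simp add: K_def)
      have "K \<le> qpoch (q powr w) q n"
        unfolding K_def w_def using q p ut t by (intro qpoch_powr_Hoelder) auto
      then have "c w n \<le> b / K"
        unfolding c_def b_def[symmetric] using b K by (intro divide_left_mono) auto
      also have "b / K = b powr (u + t) / K"
        using b ut(2) by simp
      also have "\<dots> = (b powr u * b powr t) / K"
        by (simp only: powr_add)
      also have "\<dots> = c \<mu> n powr u * c \<nu> n powr t"
        unfolding c_def b_def[symmetric] K_def
        using b Q[OF p(1), of n] Q[OF p(2), of n] by (simp add: powr_divide)
      finally show ?thesis .
    qed
    have "F w \<le> F \<mu> powr u * F \<nu> powr t"
      unfolding F_def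
      using ut t(1) Fpos[OF p(1)] Fpos[OF p(2)]
      by (intro suminf_Hoelder sm nonneg p w term_le) (simp_all add: F_def)
    then have "ln (F w) \<le> ln (F \<mu> powr u * F \<nu> powr t)"
      using Fpos[OF w] by (intro ln_mono) auto
    also have "\<dots> = u * ln (F \<mu>) + t * ln (F \<nu>)"
      using Fpos[OF p(1)] Fpos[OF p(2)] by (simp add: ln_mult)
    finally show ?thesis by (simp add: u_def w_def)
  qed
  then have "convex_on {0<..} (\<lambda>\<mu>. ln (F \<mu>))"
    by (intro convex_onI) auto
  then show ?thesis
    unfolding log_convex_on_def F using Fpos by simp
qed

text \<open>If no \<open>k \<le> n\<close> has both \<open>h k\<close> and \<open>h (n - k)\<close>
  nonzero, the coefficient is exactly 0, hence the condition for strictness. Likewise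
  \<open>h = 0\<close> would give the zero function, which has no logarithm.\<close>

theorem theorem4:
  fixes h :: "nat \<Rightarrow> real" and q :: real
  assumes "\<And>n. 0 \<le> h n" and "0 < q" and "q < 1"
  shows "(\<forall>\<mu>>0. \<forall>\<alpha>>0. \<forall>\<beta>>0. \<forall>n>0.
            fps_nth (turanian h q \<mu> \<alpha> \<beta>) n \<le> 0 \<and>
            ((\<exists>k\<le>n. h k \<noteq> 0 \<and> h (n - k) \<noteq> 0) \<longrightarrow>
              fps_nth (turanian h q \<mu> \<alpha> \<beta>) n < 0))
       \<and> ((\<exists>n. h n \<noteq> 0) \<longrightarrow>
            (\<forall>x>0. x \<in> hdomain h q \<longrightarrow>
              log_convex_on {0<..} (\<lambda>\<mu>. eval_fps (hseries h q (q powr \<mu>)) x)))"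
  by (intro conjI allI impI turanian_nth_neg[OF assms] log_convex_on_hseries[OF assms(1) _ assms(2,3)])
    assumption+

end
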